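(* For every integer $k\ge1$, $$2L\left(\frac{2}{2k+1}\right)+\sum_{r=1}^{k-1}L\left(\frac{4}{(2r+1)^2}\right)+L\left(\frac34\right)-L\left(\frac12\right)=\frac{\pi^2}{4}.$$
   Context: $L$ denotes Rogers' dilogarithm function: $L(x):=\mathrm{Li}_2(x)+\frac12\log(x)\log(1-x)$ for $x\in(0,1)$, where $\mathrm{Li}_2(x)=\sum_{n\ge1}\frac{x^n}{n^2}$. *)

theory Defs
  imports Complex_Main
begin

definition Li2 :: "real \<Rightarrow> real" where
  "Li2 x = (\<Sum>n. x ^ Suc n / (real (Suc n))\<^sup>2)"

(* Rogers' dilogarithm, meaningful for 0 < x < 1 only; outside that interval the value is
   whatever the total functions ln and suminf happen to give. Normalized so that
   L(x) tends to pi^2/6 as x tends to 1 (no factor 6/pi^2). *)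
definition rogers_L :: "real \<Rightarrow> real" where
  "rogers_L x = Li2 x + 1/2 * ln x * ln (1 - x)"

end

theory Submission
  imports Defs "HOL-Analysis.Gamma_Function" "HOL-Real_Asymp.Real_Asymp"
begin

text \<open>
  The sum telescopes.  Abel's duplication formula
  \<open>L(x\<^sup>2) = 2 L(x) - 2 L(x / (1 + x))\<close>, taken at \<open>x = 2 / (2r + 1)\<close> where
  \<open>x / (1 + x) = 2 / (2r + 3)\<close>, shows that the left-hand side does not depend on \<open>k\<close>.
  At \<open>k = 1\<close> it equals \<open>2 L(2/3) + L(3/4) - L(1/2)\<close>; the reflection formula
  \<open>L(x) + L(1 - x) = \<pi>\<^sup>2 / 6\<close> at \<open>1/3\<close>, \<open>1/4\<close>, \<open>1/2\<close> together with the
  duplication formula at \<open>1/2\<close> gives its value.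

  Each of the two functional equations holds because the difference of its sides has
  derivative zero on \<open>(0,1)\<close>, so that it is determined by its limit at \<open>0\<close>.
  These limits are found from the continuity of \<open>Li\<^sub>2\<close> on \<open>[0,1]\<close>, with
  \<open>Li\<^sub>2(0) = 0\<close> and \<open>Li\<^sub>2(1) = \<pi>\<^sup>2 / 6\<close> (Euler's sum of inverse squares).
\<close>

lemma summable_inverse_squares_Suc: "summable (\<lambda>n. 1 / (real (Suc n))\<^sup>2)"
  using sums_summable[OF inverse_squares_sums] by (simp add: add.commute)

lemma Li2_0: "Li2 0 = 0"
  by (simp add: Li2_def)

lemma Li2_1: "Li2 1 = pi\<^sup>2 / 6"
  using sums_unique[OF inverse_squares_sums] by (simp add: Li2_def add.commute)

lemma norm_Li2_term_le:
  assumes "\<bar>x\<bar> \<le> 1"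
  shows "norm (x ^ Suc n / (real (Suc n))\<^sup>2) \<le> 1 / (real (Suc n))\<^sup>2"
proof -
  have "\<bar>x\<bar> ^ Suc n \<le> 1"
    using assms by (intro power_le_one) auto
  then have "\<bar>x\<bar> ^ Suc n / (real (Suc n))\<^sup>2 \<le> 1 / (real (Suc n))\<^sup>2"
    by (intro divide_right_mono) auto
  then show ?thesis
    by (simp add: abs_mult power_abs del: of_nat_Suc)
qed

lemma continuous_on_Li2: "continuous_on {-1..1} Li2"
proof -
  have "uniform_limit {-1..1} (\<lambda>N x. \<Sum>n<N. x ^ Suc n / (real (Suc n))\<^sup>2)
          (\<lambda>x. \<Sum>n. x ^ Suc n / (real (Suc n))\<^sup>2) sequentially"
    by (rule Weierstrass_m_test[OF _ summable_inverse_squares_Suc])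
       (rule norm_Li2_term_le, auto)
  then have "continuous_on {-1..1} (\<lambda>x. \<Sum>n. x ^ Suc n / (real (Suc n))\<^sup>2)"
    by (rule uniform_limit_theorem[rotated])
       (auto intro!: always_eventually continuous_intros)
  then show ?thesis
    by (simp add: Li2_def[abs_def])
qed

lemma Li2_eq_power_series:
  assumes "\<bar>x\<bar> \<le> 1"
  shows "Li2 x = (\<Sum>n. 1 / (real n)\<^sup>2 * x ^ n)"
proof -
  have "summable (\<lambda>n. x ^ Suc n / (real (Suc n))\<^sup>2)"
    by (rule summable_comparison_test'[OF summable_inverse_squares_Suc norm_Li2_term_le[OF assms]])
  then have "(\<lambda>n. 1 / (real (Suc n))\<^sup>2 * x ^ Suc n) sums Li2 x"
    unfolding Li2_def by (simp add: summable_sums)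
  \<comment> \<open>The additional term at index 0 is \<open>1 / 0 * x ^ 0 = 0\<close>.\<close>
  then have "(\<lambda>n. 1 / (real n)\<^sup>2 * x ^ n) sums Li2 x"
    by (subst (asm) sums_Suc_iff) simp
  then show ?thesis
    by (rule sums_unique)
qed

lemma has_real_derivative_Li2:
  assumes x: "0 < x" "x < 1"
  shows "(Li2 has_real_derivative - ln (1 - x) / x) (at x)"
proof -
  define c :: "nat \<Rightarrow> real" where "c = (\<lambda>n. 1 / (real n)\<^sup>2)"
  have diffs: "diffs c n = 1 / real (Suc n)" for n
    by (simp add: diffs_def c_def power2_eq_square del: of_nat_Suc)
  have "summable c"
    using summable_inverse_squares_Suc unfolding c_def by (subst (asm) summable_Suc_iff)
  then have "DERIV (\<lambda>x. \<Sum>n. c n * x ^ n) x :> (\<Sum>n. diffs c n * x ^ n)"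
    using x by (intro termdiffs_strong[where K = 1]) auto
  also have "(\<Sum>n. diffs c n * x ^ n) = - ln (1 - x) / x"
  proof -
    have "(\<lambda>n. - (x ^ n) / real n) sums ln (1 - x)"
      using ln_series'[of "- x"] x by simp
    then have "(\<lambda>n. - (x ^ Suc n) / real (Suc n)) sums ln (1 - x)"
      by (subst sums_Suc_iff) simp
    then have "(\<lambda>n. (- 1 / x) * (- (x ^ Suc n) / real (Suc n))) sums ((- 1 / x) * ln (1 - x))"
      by (rule sums_mult)
    then have "(\<lambda>n. diffs c n * x ^ n) sums (- ln (1 - x) / x)"
      using x by (simp add: diffs)
    then show ?thesis
      by (rule sums_unique[symmetric])
  qed
  finally have "DERIV (\<lambda>x. \<Sum>n. c n * x ^ n) x :> - ln (1 - x) / x" .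
  then show ?thesis
  proof (rule has_field_derivative_transform_within_open)
    show "open {-1<..<1::real}" "x \<in> {-1<..<1}"
      using x by auto
    show "(\<Sum>n. c n * y ^ n) = Li2 y" if "y \<in> {-1<..<1}" for y
      using that Li2_eq_power_series[of y] by (simp add: c_def abs_le_iff)
  qed
qed

lemma has_real_derivative_rogers_L:
  assumes x: "0 < x" "x < 1"
  shows "(rogers_L has_real_derivative - (ln (1 - x) / x + ln x / (1 - x)) / 2) (at x)"
  unfolding rogers_L_def[abs_def]
  by (rule derivative_eq_intros has_real_derivative_Li2 x refl | use x in \<open>simp; fail\<close>)+
     (use x in \<open>simp add: field_simps\<close>)

lemma tendsto_rogers_L_0: "(rogers_L \<longlongrightarrow> 0) (at_right 0)"
proof -
  have "(Li2 \<longlongrightarrow> Li2 0) (at_right 0)"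
    using continuous_on_Li2 by (intro continuous_on_tendsto_compose[of "{-1..1}" Li2])
      (auto simp: eventually_at_right_field intro!: tendsto_eq_intros exI[of _ 1])
  moreover have "((\<lambda>x::real. 1/2 * ln x * ln (1 - x)) \<longlongrightarrow> 0) (at_right 0)"
    by real_asymp
  ultimately have "(rogers_L \<longlongrightarrow> Li2 0 + 0) (at_right 0)"
    unfolding rogers_L_def[abs_def] by (rule tendsto_add)
  then show ?thesis
    by (simp add: Li2_0)
qed

lemma tendsto_rogers_L_one_minus: "((\<lambda>x. rogers_L (1 - x)) \<longlongrightarrow> pi\<^sup>2 / 6) (at_right 0)"
proof -
  have "((\<lambda>x. Li2 (1 - x)) \<longlongrightarrow> Li2 1) (at_right 0)"
    using continuous_on_Li2 by (intro continuous_on_tendsto_compose[of "{-1..1}" Li2])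
      (auto simp: eventually_at_right_field intro!: tendsto_eq_intros exI[of _ 1])
  moreover have "((\<lambda>x::real. 1/2 * ln (1 - x) * ln (1 - (1 - x))) \<longlongrightarrow> 0) (at_right 0)"
    by real_asymp
  ultimately have "((\<lambda>x. rogers_L (1 - x)) \<longlongrightarrow> Li2 1 + 0) (at_right 0)"
    unfolding rogers_L_def by (rule tendsto_add)
  then show ?thesis
    by (simp add: Li2_1)
qed

lemma eq_limit_at_right_if_deriv_zero:
  fixes f :: "real \<Rightarrow> real"
  assumes deriv: "\<And>x. \<lbrakk>a < x; x < b\<rbrakk> \<Longrightarrow> (f has_real_derivative 0) (at x)"
    and lim: "(f \<longlongrightarrow> l) (at_right a)"
    and x: "a < x" "x < b"
  shows "f x = l"
proof -
  have "\<exists>c. \<forall>y\<in>{a<..<b}. f y = c"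
    by (rule has_field_derivative_zero_constant)
       (auto intro: has_field_derivative_at_within deriv)
  then obtain c where c: "\<And>y. y \<in> {a<..<b} \<Longrightarrow> f y = c"
    by blast
  have "\<forall>\<^sub>F y in at_right a. f y = c"
    using x c by (auto simp: eventually_at_right_field intro!: exI[of _ b])
  then have "((\<lambda>_. c) \<longlongrightarrow> l) (at_right a)"
    using lim by (rule Lim_transform_eventually[rotated])
  then have "c = l"
    by (simp add: tendsto_const_iff)
  then show ?thesis
    using c x by simp
qed

text \<open>Euler's reflection formula.\<close>

lemma rogers_L_reflection:
  assumes "0 < x" "x < 1"
  shows "rogers_L x + rogers_L (1 - x) = pi\<^sup>2 / 6"
proof (rule eq_limit_at_right_if_deriv_zero[of 0 1 "\<lambda>x. rogers_L x + rogers_L (1 - x)"])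
  show "((\<lambda>x. rogers_L x + rogers_L (1 - x)) has_real_derivative 0) (at y)"
    if y: "0 < y" "y < 1" for y
    by (rule derivative_eq_intros has_real_derivative_rogers_L
             DERIV_chain2[OF has_real_derivative_rogers_L] refl | use y in \<open>simp; fail\<close>)+
  show "((\<lambda>x. rogers_L x + rogers_L (1 - x)) \<longlongrightarrow> pi\<^sup>2 / 6) (at_right 0)"
    using tendsto_add[OF tendsto_rogers_L_0 tendsto_rogers_L_one_minus] by simp
qed (use assms in auto)

text \<open>Abel's duplication formula.\<close>

lemma rogers_L_duplication:
  assumes "0 < x" "x < 1"
  shows "rogers_L (x\<^sup>2) = 2 * rogers_L x - 2 * rogers_L (x / (1 + x))"
proof -
  define f where "f = (\<lambda>x. rogers_L (x\<^sup>2) - 2 * rogers_L x + 2 * rogers_L (x / (1 + x)))"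
  have "f x = 0"
  proof (rule eq_limit_at_right_if_deriv_zero[of 0 1 f])
    fix y :: real
    assume y: "0 < y" "y < 1"
    define D where "D = (\<lambda>t::real. - (ln (1 - t) / t + ln t / (1 - t)) / 2)"
    have sq: "0 < y\<^sup>2" "y\<^sup>2 < 1"
      using y by (auto simp: power_less_one_iff)
    have fr: "0 < y / (1 + y)" "y / (1 + y) < 1"
      using y by auto
    have L': "(rogers_L has_real_derivative D t) (at t)" if "0 < t" "t < 1" for t
      using has_real_derivative_rogers_L[OF that] by (simp add: D_def)
    have "((\<lambda>y. y / (1 + y)) has_real_derivative 1 / (1 + y)\<^sup>2) (at y)"
      using y by (auto intro!: derivative_eq_intros simp: power2_eq_square field_simps)
    moreover have "((\<lambda>y. y\<^sup>2) has_real_derivative 2 * y) (at y)"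
      by (auto intro!: derivative_eq_intros)
    ultimately have "(f has_real_derivative
        D (y\<^sup>2) * (2 * y) - 2 * D y + 2 * (D (y / (1 + y)) * (1 / (1 + y)\<^sup>2))) (at y)"
      unfolding f_def
      by (intro DERIV_add DERIV_diff DERIV_cmult DERIV_chain2[OF L'] L' y sq fr)
    moreover have "D (y\<^sup>2) * (2 * y) - 2 * D y + 2 * (D (y / (1 + y)) * (1 / (1 + y)\<^sup>2)) = 0"
    proof -
      define A B C where "A = ln y" and "B = ln (1 - y)" and "C = ln (1 + y)"
      have "1 - y\<^sup>2 = (1 - y) * (1 + y)"
        by (simp add: algebra_simps power2_eq_square)
      then have "ln (1 - y\<^sup>2) = B + C"
        using y by (simp add: ln_mult B_def C_def)
      moreover have "ln (y\<^sup>2) = 2 * A"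
        using y by (simp add: ln_realpow A_def)
      ultimately have Dsq: "D (y\<^sup>2) = - ((B + C) / y\<^sup>2 + 2 * A / (1 - y\<^sup>2)) / 2"
        by (simp add: D_def)
      have "1 - y / (1 + y) = 1 / (1 + y)"
        using y by (simp add: field_simps)
      moreover have "ln (y / (1 + y)) = A - C"
        using y by (simp add: ln_div A_def C_def)
      moreover have "ln (1 / (1 + y)) = - C"
        using y by (simp add: ln_div C_def)
      ultimately have Dfr: "D (y / (1 + y)) = - (- C / (y / (1 + y)) + (A - C) / (1 / (1 + y))) / 2"
        by (simp add: D_def)
      have Dy: "D y = - (B / y + A / (1 - y)) / 2"
        by (simp add: D_def A_def B_def)
      have nz: "y \<noteq> 0" "1 + y \<noteq> 0" "1 - y \<noteq> 0" "1 - y\<^sup>2 = (1 - y) * (1 + y)"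
        using y by (auto simp: algebra_simps power2_eq_square)
      show ?thesis
        unfolding Dsq Dfr Dy nz(4) using nz(1-3)
        by (simp add: divide_simps) algebra
    qed
    ultimately show "(f has_real_derivative 0) (at y)"
      by simp
  next
    have sq: "filterlim (\<lambda>x::real. x\<^sup>2) (at_right 0) (at_right 0)"
      by real_asymp
    have fr: "filterlim (\<lambda>x::real. x / (1 + x)) (at_right 0) (at_right 0)"
      by real_asymp
    show "(f \<longlongrightarrow> 0) (at_right 0)"
      unfolding f_def
      by (auto intro!: tendsto_eq_intros tendsto_rogers_L_0
            filterlim_compose[OF tendsto_rogers_L_0 sq] filterlim_compose[OF tendsto_rogers_L_0 fr])
  qed (use assms in auto)
  then show ?thesis
    by (simp add: f_def)
qed

theorem proposition6p3:
  fixes k :: nat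
  assumes "k \<ge> 1"
  shows "2 * rogers_L (2 / (2 * real k + 1))
       + (\<Sum>r = 1..k - 1. rogers_L (4 / (2 * real r + 1)\<^sup>2))
       + rogers_L (3 / 4) - rogers_L (1 / 2) = pi\<^sup>2 / 4"
  using assms
proof (induction k rule: dec_induct)
  case base
  have "rogers_L (1/3) + rogers_L (2/3) = pi\<^sup>2 / 6"
    using rogers_L_reflection[of "1/3"] by simp
  moreover have "rogers_L (1/4) + rogers_L (3/4) = pi\<^sup>2 / 6"
    using rogers_L_reflection[of "1/4"] by simp
  moreover have "rogers_L (1/2) + rogers_L (1/2) = pi\<^sup>2 / 6"
    using rogers_L_reflection[of "1/2"] by simp
  moreover have "rogers_L (1/4) = 2 * rogers_L (1/2) - 2 * rogers_L (1/3)"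
    using rogers_L_duplication[of "1/2"] by (simp add: power2_eq_square)
  ultimately show ?case
    by simp
next
  case (step n)
  define x where "x = 2 / (2 * real n + 1)"
  have x: "0 < x" "x < 1"
    using step.hyps by (auto simp: x_def)
  have "x / (1 + x) = 2 / (2 * real (Suc n) + 1)"
    by (simp add: x_def divide_simps)
  moreover have "x\<^sup>2 = 4 / (2 * real n + 1)\<^sup>2"
    by (simp add: x_def power_divide)
  ultimately have "rogers_L (4 / (2 * real n + 1)\<^sup>2) =
      2 * rogers_L (2 / (2 * real n + 1)) - 2 * rogers_L (2 / (2 * real (Suc n) + 1))"
    using rogers_L_duplication[OF x] by (simp add: x_def)
  moreover have "(\<Sum>r = 1..Suc n - 1. rogers_L (4 / (2 * real r + 1)\<^sup>2)) =
      (\<Sum>r = 1..n - 1. rogers_L (4 / (2 * real r + 1)\<^sup>2)) + rogers_L (4 / (2 * real n + 1)\<^sup>2)"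
    using step.hyps by (cases n) auto
  ultimately show ?case
    using step.IH by linarith
qed

end
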